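(* In the presence of honest-but-curious or eavesdropping adversaries, algorithm PDG-DS protects the privacy of all participating agents. That is, for every agent $i$, every finite number of iterations $T$, every collection of (nonzero) gradient values $g_i^1,\dots,g_i^T$ of agent $i$ arising in a run of PDG-DS, and all real numbers $\zeta^1,\dots,\zeta^T$ (arbitrarily large, possibly different for different $k$), there exist alternative gradient values $\hat g_i^1,\dots,\hat g_i^T\in\mathbb{R}^d$ with $$\log\frac{\|\hat g_i^k\|}{\|g_i^k\|}=\zeta^k,\qquad k=1,\dots,T,$$ and an alternative admissible realization of agent $i$'s private parameters, such that the information $\mathcal{I}_i$ shared by agent $i$ is identical to the information it shares in the original run.
   Context: Setting: $m$ agents interact on an undirected graph with nonnegative weight matrix $W=\{w_{ij}\}\in\mathbb{R}^{m\times m}$, with $w_{ij}>0$ iff agents $i,j$ can interact, $w_{ii}>0$, $\mathbb{N}_i=\{j:w_{ij}>0\}$, $W\mathbf{1}=\mathbf{1}$, $\mathbf{1}^TW=\mathbf{1}^T$, $\|W-\frac{\mathbf{1}\mathbf{1}^T}{m}\|<1$. Agent $i$ has a private objective $f_i:\mathbb{R}^d\to\mathbb{R}$. Algorithm PDG-DS: at each iteration $k=0,1,\dots$, every agent $j$ sends to each $i\in\mathbb{N}_j$ the message $v_{ij}^k=w_{ij}x_j^k-b_{ij}^k\lambda_j^kg_j^k$, where $g_j^k$ is the gradient of $f_j$ at $x_j^k$, and then each agent $i$ sets $x_i^{k+1}=\sum_{j\in\mathbb{N}_i}v_{ij}^k$. The matrix $W$ is public. The private parameters of agent $i$ are $x_i^0$,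 the stepsizes $\lambda_i^k$, and the coefficients $b_{ji}^k$, $j\in\mathbb{N}_i$. They are admissible if $\lambda_i^k\ge0$ for all $k$, $\lambda_i^k\to0$ as $k\to\infty$ (diminishing stepsizes), $b_{ji}^k>0$ for $j\in\mathbb{N}_i$ and $\sum_{j\in\mathbb{N}_i}b_{ji}^k=1$. Adversaries: honest-but-curious adversaries are participating agents (colluding or not) that follow the protocol but collect all received data to learn about other agents; eavesdropping adversaries are external parties that wiretap all communication channels. In either case the information obtained from agent $i$ is contained in the information it shares, $\mathcal{I}_i=\mathcal{I}_i^{\rm sent}\cup\mathcal{I}_i^{\rm public}$, where $\mathcal{I}_i^{\rm sent}=\{v_{ji}^k=w_{ji}x_i^k-b_{ji}^k\lambda_i^kg_i^k : j\in\mathbb{N}_i,\ k=1,2,\dots\}$ and $\mathcal{I}_i^{\rm public}$ consists of $W$ and the relations $\sum_{j\in\mathbb{N}_i}b_{ji}^k=1$, $k=0,1,\dots$. Privacy definition: the difference from $x$ to $x'$ is $\zeta=\log\frac{\|x\|}{\|x'\|}$ (positive or negative). The privacy of agent $i$ is preserved if for any finite number of iterations $T$, its gradient values $g_i^1,\dots,g_i^T$ always have alternative realizations $\hat g_i^1,\dots,\hat g_i^T$ which allow each $\hat g_i^k$ ($1\le k\le T$) to have an arbitrarily large difference from $g_i^k$ (possibly different for different $k$), but lead to the same shared information in inter-agent communications. Gradient values are regarded as the vectors $g_i^k$ entering the messages; gradient values at iterations other than $1,\dots,T$ are unchanged. *)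

theory Defs
  imports "HOL-Analysis.Analysis"
begin

text \<open>
  Agents are the elements of a finite type \<open>'m\<close>, so \<open>m\<close> is \<open>CARD('m)\<close>; the state space is
  \<open>real ^ 'd\<close>. The entry \<open>w\<^sub>i\<^sub>j\<close> of the weight matrix is \<open>W $ i $ j\<close>.
\<close>

definition nbhd :: "real ^ 'm ^ 'm \<Rightarrow> 'm \<Rightarrow> 'm set" where
  "nbhd W i = {j. W $ i $ j > 0}"

text \<open>
  The interaction graph is the support of \<open>W\<close>, which has to be symmetric, although \<open>W\<close> itself need
  not be. The operator norm appears explicitly because \<open>norm\<close> on the matrix type is the Frobenius norm.
  The vector \<open>1\<close> has all entries equal to one.
\<close>

definition weight_matrix :: "real ^ 'm ^ 'm \<Rightarrow> bool" where
  "weight_matrix W \<longleftrightarrow>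
     (\<forall>i j. W $ i $ j \<ge> 0) \<and>
     (\<forall>i j. j \<in> nbhd W i \<longleftrightarrow> i \<in> nbhd W j) \<and>
     (\<forall>i. W $ i $ i > 0) \<and>
     W *v 1 = 1 \<and> 1 v* W = 1 \<and>
     onorm ((*v) (W - (\<chi> i j. 1 / real CARD('m)))) < 1"

text \<open>
  For agent \<open>i\<close>, \<open>coupling p j k\<close> is \<open>b\<^sub>j\<^sub>i\<^sup>k\<close>: coefficients belong to the sender \<open>i\<close>, and \<open>j\<close> is the
  receiver. Only its values at neighbours \<open>j\<close> of \<open>i\<close> are ever used.
\<close>

record ('m, 'v) private_params =
  init :: 'v
  stepsize :: "nat \<Rightarrow> real"
  coupling :: "'m \<Rightarrow> nat \<Rightarrow> real"

definition admissible ::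
    "real ^ 'm ^ 'm \<Rightarrow> 'm \<Rightarrow> ('m, real ^ 'd) private_params \<Rightarrow> bool" where
  "admissible W i p \<longleftrightarrow>
     (\<forall>k. stepsize p k \<ge> 0) \<and> stepsize p \<longlonglongrightarrow> 0 \<and>
     (\<forall>k. \<forall>j \<in> nbhd W i. coupling p j k > 0) \<and>
     (\<forall>k. (\<Sum>j \<in> nbhd W i. coupling p j k) = 1)"

text \<open>
  In what follows \<open>P i\<close> are the private parameters of agent \<open>i\<close>, \<open>x i k\<close> is its state and \<open>g i k\<close> is
  the vector it uses as gradient at iteration \<open>k\<close>. The message \<open>v\<^sub>j\<^sub>i\<^sup>k\<close> is the one from \<open>i\<close> to \<open>j\<close>.
\<close>

definition message ::
    "real ^ 'm ^ 'm \<Rightarrow> ('m \<Rightarrow> ('m, real ^ 'd) private_params) \<Rightarrow>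
     ('m \<Rightarrow> nat \<Rightarrow> real ^ 'd) \<Rightarrow> ('m \<Rightarrow> nat \<Rightarrow> real ^ 'd) \<Rightarrow> 'm \<Rightarrow> 'm \<Rightarrow> nat \<Rightarrow> real ^ 'd" where
  "message W P x g j i k =
     (W $ j $ i) *\<^sub>R x i k - (coupling (P i) j k * stepsize (P i) k) *\<^sub>R g i k"

text \<open>
  The update rule for arbitrary vectors \<open>g i k\<close> in the role of gradients; that an agent really uses
  the gradients of its objective is expressed separately.
\<close>

definition pdg_ds_run ::
    "real ^ 'm ^ 'm \<Rightarrow> ('m \<Rightarrow> ('m, real ^ 'd) private_params) \<Rightarrow>
     ('m \<Rightarrow> nat \<Rightarrow> real ^ 'd) \<Rightarrow> ('m \<Rightarrow> nat \<Rightarrow> real ^ 'd) \<Rightarrow> bool" where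
  "pdg_ds_run W P x g \<longleftrightarrow>
     (\<forall>i. x i 0 = init (P i)) \<and>
     (\<forall>i k. x i (Suc k) = (\<Sum>j \<in> nbhd W i. message W P x g i j k))"

definition uses_gradients ::
    "('m \<Rightarrow> real ^ 'd \<Rightarrow> real) \<Rightarrow> ('m \<Rightarrow> nat \<Rightarrow> real ^ 'd) \<Rightarrow> ('m \<Rightarrow> nat \<Rightarrow> real ^ 'd) \<Rightarrow> 'm \<Rightarrow> bool"
  where "uses_gradients f x g j \<longleftrightarrow> (\<forall>k. GDERIV (f j) (x j k) :> g j k)"

text \<open>
  Messages are tagged with receiver and iteration, since an adversary can tell them apart; a bare
  set of values would carry less information.
\<close>

definition sent_info ::
    "real ^ 'm ^ 'm \<Rightarrow> ('m \<Rightarrow> ('m, real ^ 'd) private_params) \<Rightarrow>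
     ('m \<Rightarrow> nat \<Rightarrow> real ^ 'd) \<Rightarrow> ('m \<Rightarrow> nat \<Rightarrow> real ^ 'd) \<Rightarrow> 'm \<Rightarrow> ('m \<times> nat \<times> (real ^ 'd)) set" where
  "sent_info W P x g i = {(j, k, message W P x g j i k) | j k. j \<in> nbhd W i \<and> k \<ge> 1}"

text \<open>The public relation at iteration \<open>k\<close> is recorded through its truth value.\<close>

definition public_info ::
    "real ^ 'm ^ 'm \<Rightarrow> ('m \<Rightarrow> ('m, real ^ 'd) private_params) \<Rightarrow> 'm \<Rightarrow>
     (real ^ 'm ^ 'm) \<times> (nat \<Rightarrow> bool)" where
  "public_info W P i = (W, \<lambda>k. (\<Sum>j \<in> nbhd W i. coupling (P i) j k) = 1)"

definition shared_info ::
    "real ^ 'm ^ 'm \<Rightarrow> ('m \<Rightarrow> ('m, real ^ 'd) private_params) \<Rightarrow>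
     ('m \<Rightarrow> nat \<Rightarrow> real ^ 'd) \<Rightarrow> ('m \<Rightarrow> nat \<Rightarrow> real ^ 'd) \<Rightarrow> 'm \<Rightarrow>
     ('m \<times> nat \<times> (real ^ 'd)) set \<times> (real ^ 'm ^ 'm) \<times> (nat \<Rightarrow> bool)" where
  "shared_info W P x g i = (sent_info W P x g i, public_info W P i)"

definition log_difference :: "real ^ 'd \<Rightarrow> real ^ 'd \<Rightarrow> real" where
  "log_difference x x' = ln (norm x / norm x')"

text \<open>
  In the alternative run only the private parameters of agent \<open>i\<close> and its gradient values at
  iterations \<open>1, \<dots>, T\<close> may change; all other agents keep their parameters, their objectives and
  their gradient values. The alternative gradient values are required to be nonzero because
  \<open>ln 0 = 0\<close> would otherwise admit \<open>0\<close> as a vector at difference \<open>0\<close>.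
\<close>

definition privacy_preserved ::
    "real ^ 'm ^ 'm \<Rightarrow> ('m \<Rightarrow> real ^ 'd \<Rightarrow> real) \<Rightarrow> ('m \<Rightarrow> ('m, real ^ 'd) private_params) \<Rightarrow>
     ('m \<Rightarrow> nat \<Rightarrow> real ^ 'd) \<Rightarrow> ('m \<Rightarrow> nat \<Rightarrow> real ^ 'd) \<Rightarrow> 'm \<Rightarrow> bool" where
  "privacy_preserved W f P x g i \<longleftrightarrow>
     (\<forall>(T::nat) (\<zeta> :: nat \<Rightarrow> real). (\<forall>k \<in> {1..T}. g i k \<noteq> 0) \<longrightarrow>
       (\<exists>(g\<^sub>i' :: nat \<Rightarrow> real ^ 'd) (p\<^sub>i' :: ('m, real ^ 'd) private_params)
          (x' :: 'm \<Rightarrow> nat \<Rightarrow> real ^ 'd).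
          (\<forall>k \<in> {1..T}. g\<^sub>i' k \<noteq> 0 \<and> log_difference (g\<^sub>i' k) (g i k) = \<zeta> k) \<and>
          (\<forall>k. k \<notin> {1..T} \<longrightarrow> g\<^sub>i' k = g i k) \<and>
          admissible W i p\<^sub>i' \<and>
          pdg_ds_run W (P(i := p\<^sub>i')) x' (g(i := g\<^sub>i')) \<and>
          (\<forall>j. j \<noteq> i \<longrightarrow> uses_gradients f x' (g(i := g\<^sub>i')) j) \<and>
          shared_info W (P(i := p\<^sub>i')) x' (g(i := g\<^sub>i')) i = shared_info W P x g i))"

end

theory Submission
  imports Defs
begin

text \<open>
  A message reveals the gradient only through the product \<open>\<lambda>\<^sub>i\<^sup>k g\<^sub>i\<^sup>k\<close>, and the stepsize \<open>\<lambda>\<^sub>i\<^sup>k\<close> is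
  private. Multiplying \<open>g\<^sub>i\<^sup>k\<close> by a positive factor \<open>c\<^sup>k\<close> and dividing \<open>\<lambda>\<^sub>i\<^sup>k\<close> by the same factor
  therefore leaves all messages as they are (\<open>message_rescale\<close>). As the states evolve through the
  messages alone, the state trajectory of the whole network is also the same, so the other agents
  evaluate their gradients at the same points as before.

  The factor \<open>c\<^sup>k = exp (\<zeta>\<^sup>k)\<close> produces the prescribed difference \<open>\<zeta>\<^sup>k\<close>. Only the finitely many
  iterations \<open>1, \<dots>, T\<close> need a factor other than \<open>1\<close>, so the new stepsizes still tend to zero
  however large the \<open>\<zeta>\<^sup>k\<close> are (\<open>admissible_rescale\<close>).
\<close>

definition rescale_stepsize ::
    "(nat \<Rightarrow> real) \<Rightarrow> ('m, 'v) private_params \<Rightarrow> ('m, 'v) private_params" where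
  "rescale_stepsize c p = p\<lparr>stepsize := \<lambda>k. stepsize p k / c k\<rparr>"

lemma rescale_stepsize_simps [simp]:
  "init (rescale_stepsize c p) = init p"
  "stepsize (rescale_stepsize c p) k = stepsize p k / c k"
  "coupling (rescale_stepsize c p) = coupling p"
  by (simp_all add: rescale_stepsize_def)

text \<open>
  Factors that are eventually \<open>1\<close> do not affect the limit of the stepsizes, whereas dividing a null
  sequence by an arbitrary positive sequence could destroy convergence to zero.
\<close>

lemma admissible_rescale:
  assumes "admissible W i p"
    and pos: "\<And>k. c k > 0"
    and "\<forall>\<^sub>F k in sequentially. c k = 1"
  shows "admissible W i (rescale_stepsize c p)"
proof -
  have "\<forall>\<^sub>F k in sequentially. stepsize p k = stepsize (rescale_stepsize c p) k"
    using assms(3) by eventually_elim simp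
  moreover have "stepsize p \<longlonglongrightarrow> 0"
    using assms(1) by (simp add: admissible_def)
  ultimately have "stepsize (rescale_stepsize c p) \<longlonglongrightarrow> 0"
    by (simp only: tendsto_cong)
  then show ?thesis
    using assms(1) by (simp add: admissible_def pos less_imp_le)
qed

lemma message_rescale:
  assumes "\<And>k. c k \<noteq> 0"
  shows "message W (P(i := rescale_stepsize c (P i))) x (g(i := \<lambda>k. c k *\<^sub>R g i k)) =
    message W P x g"
  by (intro ext) (simp add: message_def assms)

lemma pdg_ds_run_cong:
  assumes "message W P' x g' = message W P x g"
    and "\<And>j. init (P' j) = init (P j)"
  shows "pdg_ds_run W P' x g' \<longleftrightarrow> pdg_ds_run W P x g"
  by (simp add: pdg_ds_run_def assms)

lemma shared_info_cong:
  assumes "message W P' x g' = message W P x g"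
    and "coupling (P' i) = coupling (P i)"
  shows "shared_info W P' x g' i = shared_info W P x g i"
  by (simp add: shared_info_def sent_info_def public_info_def assms)

lemma log_difference_exp_scale:
  assumes "v \<noteq> 0"
  shows "log_difference (exp a *\<^sub>R v) v = a"
  using assms by (simp add: log_difference_def)

theorem theorem2:
  fixes W :: "real ^ 'm ^ 'm"
    and f :: "'m \<Rightarrow> real ^ 'd \<Rightarrow> real"
    and P :: "'m \<Rightarrow> ('m, real ^ 'd) private_params"
    and x g :: "'m \<Rightarrow> nat \<Rightarrow> real ^ 'd"
  assumes "weight_matrix W"
    and "\<And>j. admissible W j (P j)"
    and "pdg_ds_run W P x g"
    and "\<And>j. uses_gradients f x g j"
  shows "\<forall>i. privacy_preserved W f P x g i"
proof (intro allI, unfold privacy_preserved_def, intro allI impI)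
  fix i T and \<zeta> :: "nat \<Rightarrow> real"
  assume nonzero: "\<forall>k\<in>{1..T}. g i k \<noteq> 0"
  define c where "c k = (if k \<in> {1..T} then exp (\<zeta> k) else 1)" for k
  define p' where "p' = rescale_stepsize c (P i)"
  define g' where "g' k = c k *\<^sub>R g i k" for k
  have c_pos: "c k > 0" for k
    by (simp add: c_def)
  have "\<forall>\<^sub>F k in sequentially. c k = 1"
    using eventually_gt_at_top[of T] by eventually_elim (simp add: c_def)
  then have adm: "admissible W i p'"
    unfolding p'_def using assms(2) c_pos by (intro admissible_rescale)
  have "c k \<noteq> 0" for k
    using c_pos[of k] by simp
  then have msg: "message W (P(i := p')) x (g(i := g')) = message W P x g"
    unfolding p'_def g'_def by (rule message_rescale)
  have run: "pdg_ds_run W (P(i := p')) x (g(i := g'))"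
    using assms(3) pdg_ds_run_cong[OF msg] by (simp add: p'_def)
  have info: "shared_info W (P(i := p')) x (g(i := g')) i = shared_info W P x g i"
    using msg by (rule shared_info_cong) (simp add: p'_def)
  have diff: "\<forall>k\<in>{1..T}. g' k \<noteq> 0 \<and> log_difference (g' k) (g i k) = \<zeta> k"
    using nonzero by (simp add: g'_def c_def log_difference_exp_scale)
  have unchanged: "\<forall>k. k \<notin> {1..T} \<longrightarrow> g' k = g i k"
    by (simp add: g'_def c_def)
  have others: "\<forall>j. j \<noteq> i \<longrightarrow> uses_gradients f x (g(i := g')) j"
    using assms(4) by (simp add: uses_gradients_def)
  \<comment> \<open>The original trajectory \<open>x\<close> also serves as the alternative one.\<close>
  show "\<exists>g\<^sub>i' p\<^sub>i' x'.
      (\<forall>k\<in>{1..T}. g\<^sub>i' k \<noteq> 0 \<and> log_difference (g\<^sub>i' k) (g i k) = \<zeta> k) \<and>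
      (\<forall>k. k \<notin> {1..T} \<longrightarrow> g\<^sub>i' k = g i k) \<and>
      admissible W i p\<^sub>i' \<and>
      pdg_ds_run W (P(i := p\<^sub>i')) x' (g(i := g\<^sub>i')) \<and>
      (\<forall>j. j \<noteq> i \<longrightarrow> uses_gradients f x' (g(i := g\<^sub>i')) j) \<and>
      shared_info W (P(i := p\<^sub>i')) x' (g(i := g\<^sub>i')) i = shared_info W P x g i"
    using diff unchanged adm run others info by blast
qed

end
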